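(* Let $m,\sigma,L_0,L,y_0$ be real numbers with $m>0$, $\sigma>0$, $0<L_0<L$ and $y_0>0$. Let $P$ be the true period of oscillation, i.e. the (least positive) period of the solution $y(t)$ of $$\frac{d^2y}{dt^2}+\left(\frac{2\sigma}{m}\,\frac{\sqrt{L^2+y^2}-L_0}{\sqrt{L^2+y^2}}\right)y=0,\qquad y(0)=y_0,\quad \dot y(0)=0,$$ and let $\overline{P}=\dfrac{2\pi}{\sqrt{\frac{2T}{mL}}}$ with $T=\sigma(L-L_0)$ be Rayleigh's approximate period. Then $\overline{P}$ overestimates $P$: the relative error $R:=\dfrac{P-\overline{P}}{P}$ satisfies $R<0$, and in fact $$\sqrt{\frac{\frac{1}{L_0}-\frac{2}{L+\sqrt{L^2+y_0^2}}}{\frac{1}{L_0}-\frac{1}{L}}}<\frac{\overline{P}}{P}<\sqrt{\frac{\frac{1}{L_0}-\frac{1}{\sqrt{L^2+y_0^2}}}{\frac{1}{L_0}-\frac{1}{L}}}.$$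
   Context: Physical setting: a horizontal elastic wire of natural length $2L_0$ is stretched to length $2L$; a body of mass $m$ is tied to its center and moves on the vertical line through the center, with vertical displacement $y(t)$. Each half of the wire exerts a tension of magnitude $\sigma(\sqrt{L^2+y^2}-L_0)$, where $\sigma$ is the spring constant; there is no gravity and no damping. Newton's law gives the nonlinear differential equation in the claim; the body starts from rest at displacement $y_0$. Rayleigh's approximation replaces the tension by the constant $T=\sigma(L-L_0)$ and the equation by $\ddot y+\frac{2T}{mL}y=0$, which has period $\overline{P}=2\pi/\sqrt{2T/(mL)}$. *)

theory Defs
  imports "HOL-Analysis.Analysis" "HOL-Library.Periodic_Fun"
begin

text \<open>
  The motion \<open>y\<close>, defined for all times, of the body started from rest at displacement \<open>y0\<close>:
  \<open>v\<close> and \<open>a\<close> are its velocity and acceleration.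
\<close>
definition wire_motion ::
  "real \<Rightarrow> real \<Rightarrow> real \<Rightarrow> real \<Rightarrow> real \<Rightarrow> (real \<Rightarrow> real) \<Rightarrow> bool" where
  "wire_motion m \<sigma> L0 L y0 y \<longleftrightarrow>
     (\<exists>v a. (\<forall>t. (y has_real_derivative v t) (at t)) \<and>
            (\<forall>t. (v has_real_derivative a t) (at t)) \<and>
            (\<forall>t. a t + (2 * \<sigma> / m * ((sqrt (L\<^sup>2 + (y t)\<^sup>2) - L0) / sqrt (L\<^sup>2 + (y t)\<^sup>2))) * y t = 0) \<and>
            y 0 = y0 \<and> v 0 = 0)"

definition least_positive_period :: "(real \<Rightarrow> real) \<Rightarrow> real \<Rightarrow> bool" where
  "least_positive_period f P \<longleftrightarrow>
     P > 0 \<and> periodic_fun_simple f P \<and> (\<forall>Q>0. periodic_fun_simple f Q \<longrightarrow> P \<le> Q)"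

definition rayleigh_period :: "real \<Rightarrow> real \<Rightarrow> real \<Rightarrow> real \<Rightarrow> real" where
  "rayleigh_period m \<sigma> L0 L = (let T = \<sigma> * (L - L0) in 2 * pi / sqrt (2 * T / (m * L)))"

definition relative_error :: "real \<Rightarrow> real \<Rightarrow> real" where
  "relative_error P Pbar = (P - Pbar) / P"

end

theory Submission
  imports Defs
begin

text \<open>
  Write \<open>k = 2\<sigma>/m\<close>, \<open>S(y) = sqrt (L\<^sup>2 + y\<^sup>2)\<close> and \<open>v\<close> for the velocity. Since
  \<open>y0\<^sup>2 - y\<^sup>2 = (S(y0) - S(y)) (S(y0) + S(y))\<close>, conservation of energy factors as
  \<open>v\<^sup>2 = (y0\<^sup>2 - y\<^sup>2) g(y)\<close> with \<open>g(y) = k (1 - 2 L0 / (S(y0) + S(y))) > 0\<close>.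

  Hence the point \<open>(y, u)\<close> with \<open>u = v / sqrt (g(y))\<close> stays on the circle of radius \<open>y0\<close>, and
  the equation of motion says exactly that it turns with angular speed \<open>sqrt (g(y))\<close>:
  \<open>y' = sqrt (g(y)) u\<close> and \<open>u' = - sqrt (g(y)) y\<close> (lemma \<open>wire_rotation\<close>).
  Therefore \<open>y = y0 cos \<theta>\<close>, where the phase satisfies the autonomous equation \<open>\<theta>' = w(\<theta>)\<close>
  with \<open>w(x) = sqrt (g(y0 cos x))\<close>, and the least positive period of \<open>y\<close> is the time that the phase
  needs to advance by \<open>2\<pi>\<close>, which is the integral of \<open>1/w\<close> over a full turn.

  As \<open>g\<close> is strictly increasing in \<open>\<bar>y\<bar>\<close>, the angular speed lies strictly between \<open>sqrt (g(0))\<close>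
  and \<open>sqrt (g(y0))\<close> except at multiples of \<open>\<pi>/2\<close>; so \<open>2\<pi>/P\<close> lies strictly between
  these two values (lemma \<open>phase_flow_period\<close>). Rayleigh's angular frequency is the square root of
  \<open>k L0 (1/L0 - 1/L)\<close>, while \<open>g(0) = k L0 (1/L0 - 2/(L + S(y0)))\<close> and
  \<open>g(y0) = k L0 (1/L0 - 1/S(y0))\<close>, which gives both bounds. The lower one exceeds \<open>1\<close> because
  \<open>S(y0) > L\<close>, so the relative error is negative.
\<close>

section \<open>Phase of a rotating point and its period\<close>

lemma antiderivative_vanishing_at_0:
  fixes f :: "real \<Rightarrow> real"
  assumes "\<And>x. isCont f x"
  obtains F where "F 0 = 0" and "\<And>x. (F has_real_derivative f x) (at x)"
proof -
  obtain F where F: "\<And>x. (F has_vector_derivative f x) (at x)"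
    using einterval_antiderivative[of "-\<infinity>" "\<infinity>" f] assms by auto
  show thesis
  proof (rule that[of "\<lambda>x. F x - F 0"])
    show "F 0 - F 0 = 0" by simp
    show "((\<lambda>x. F x - F 0) has_real_derivative f x) (at x)" for x
      using F[of x] by (auto simp: has_real_derivative_iff_has_vector_derivative
          intro!: derivative_eq_intros)
  qed
qed

text \<open>
  A point \<open>(y, u)\<close> that turns about the origin with variable angular speed \<open>\<omega>\<close> is constant in
  the frame \<open>(p, q)\<close> that turns along with it.
\<close>
lemma rotating_frame_cos:
  fixes y u \<omega> \<theta> :: "real \<Rightarrow> real"
  assumes y: "\<And>t. (y has_real_derivative \<omega> t * u t) (at t)"
    and u: "\<And>t. (u has_real_derivative - (\<omega> t * y t)) (at t)"
    and \<theta>: "\<And>t. (\<theta> has_real_derivative \<omega> t) (at t)"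
    and init: "u 0 = 0" "\<theta> 0 = 0"
  shows "y t = y 0 * cos (\<theta> t)"
proof -
  define p where "p = (\<lambda>t. y t * cos (\<theta> t) - u t * sin (\<theta> t))"
  define q where "q = (\<lambda>t. y t * sin (\<theta> t) + u t * cos (\<theta> t))"
  have "(p has_real_derivative 0) (at t)" for t
    unfolding p_def by (auto intro!: derivative_eq_intros y u \<theta> simp: algebra_simps)
  then have "p t = p 0"
    by (intro DERIV_isconst_all) auto
  moreover have "(q has_real_derivative 0) (at t)" for t
    unfolding q_def by (auto intro!: derivative_eq_intros y u \<theta> simp: algebra_simps)
  then have "q t = q 0"
    by (intro DERIV_isconst_all) auto
  moreover have "y t * ((cos (\<theta> t))\<^sup>2 + (sin (\<theta> t))\<^sup>2) = p t * cos (\<theta> t) + q t * sin (\<theta> t)"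
    unfolding p_def q_def by algebra
  ultimately show ?thesis
    by (simp add: p_def q_def init)
qed

text \<open>
  The period of the cosine of a phase that moves with speed \<open>w(\<theta>)\<close>. Here \<open>sin (2x) = 0\<close> describes
  the multiples of \<open>\<pi>/2\<close>, where strictness of the bounds on the speed is not required.
\<close>
lemma phase_flow_period:
  fixes y w \<theta> :: "real \<Rightarrow> real" and A a b :: real
  assumes A: "A \<noteq> 0" and y: "\<And>t. y t = A * cos (\<theta> t)"
    and \<theta>: "\<And>t. (\<theta> has_real_derivative w (\<theta> t)) (at t)" and \<theta>0: "\<theta> 0 = 0"
    and cont: "\<And>x. isCont w x" and pos: "\<And>x. 0 < w x" and per: "\<And>x. w (x + 2 * pi) = w x"
    and a: "0 < a" and ab: "\<And>x. sin (2 * x) \<noteq> 0 \<Longrightarrow> a < w x \<and> w x < b"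
  obtains P where "least_positive_period y P" and "2 * pi / b < P" and "P < 2 * pi / a"
proof -
  \<comment> \<open>\<open>G x\<close> is the time at which the phase reaches \<open>x\<close>, so that \<open>G\<close> is inverse to \<open>\<theta>\<close>.\<close>
  have "isCont (\<lambda>x. 1 / w x) x" for x
    using cont[of x] pos[of x] by (auto intro!: continuous_intros)
  then obtain G where G0: "G 0 = 0" and G: "\<And>x. (G has_real_derivative 1 / w x) (at x)"
    using antiderivative_vanishing_at_0 by blast
  have mono: "strict_mono G"
    using G pos by (intro strict_monoI) (metis DERIV_pos_imp_increasing zero_less_divide_1_iff)
  have G\<theta>: "G (\<theta> t) = t" for t
  proof -
    have "((\<lambda>t. G (\<theta> t) - t) has_real_derivative 0) (at t)" for t
      using pos[of "\<theta> t"] by (auto intro!: derivative_eq_intros DERIV_chain2[OF G \<theta>])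
    then have "G (\<theta> t) - t = G (\<theta> 0) - 0"
      by (intro DERIV_isconst_all[of "\<lambda>t. G (\<theta> t) - t"]) auto
    then show ?thesis
      by (simp add: \<theta>0 G0)
  qed
  define P where "P = G (2 * pi)"
  have shift: "G (x + 2 * pi) = G x + P" for x
  proof -
    have "((\<lambda>x. G (x + 2 * pi) - G x) has_real_derivative 0) (at x)" for x
      using G[of "x + 2 * pi"] by (auto intro!: derivative_eq_intros G simp: DERIV_shift per)
    then have "G (x + 2 * pi) - G x = G (0 + 2 * pi) - G 0"
      by (intro DERIV_isconst_all[of "\<lambda>x. G (x + 2 * pi) - G x"]) auto
    then show ?thesis
      by (simp add: P_def G0)
  qed
  have "0 < P"
    using strict_monoD[OF mono, of 0 "2 * pi"] by (simp add: P_def G0)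
  moreover have "y (t + P) = y t" for t
  proof -
    have "G (\<theta> (t + P)) = G (\<theta> t + 2 * pi)"
      by (simp add: G\<theta> shift)
    then have "\<theta> (t + P) = \<theta> t + 2 * pi"
      using mono by (simp add: strict_mono_eq)
    then show ?thesis
      by (simp add: y)
  qed
  moreover have "P \<le> Q" if "0 < Q" and Q: "\<And>t. y (t + Q) = y t" for Q
  proof -
    have "cos (\<theta> Q) = 1"
      using Q[of 0] A by (simp add: y \<theta>0)
    then obtain n :: int where n: "\<theta> Q = n * 2 * pi"
      by (auto simp: cos_one_2pi_int)
    have "G 0 < G (\<theta> Q)"
      using \<open>0 < Q\<close> by (simp add: G\<theta> G0)
    then have "0 < \<theta> Q"
      using mono by (simp add: strict_mono_less)
    then have "1 \<le> n"
      by (simp add: n zero_less_mult_iff)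
    then have "2 * pi \<le> \<theta> Q"
      by (simp add: n)
    then have "G (2 * pi) \<le> G (\<theta> Q)"
      using mono by (simp add: strict_mono_less_eq)
    then show ?thesis
      by (simp add: P_def G\<theta>)
  qed
  ultimately have "least_positive_period y P"
    unfolding least_positive_period_def periodic_fun_simple_def by blast
  \<comment> \<open>The mean value theorem is applied on each quarter turn separately, because on a full turn the
    intermediate point could be a multiple of \<open>\<pi>/2\<close>, where the bounds need not be strict.\<close>
  moreover have quarter: "pi / 2 / b < G ((j + 1) * (pi / 2)) - G (j * (pi / 2)) \<and>
      G ((j + 1) * (pi / 2)) - G (j * (pi / 2)) < pi / 2 / a" if j: "j = of_int i" for j i
  proof -
    have "j * (pi / 2) < (j + 1) * (pi / 2)"
      by simp
    from MVT2[OF this, of G "\<lambda>x. 1 / w x"] G obtain z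
      where z: "j * (pi / 2) < z" "z < (j + 1) * (pi / 2)"
        and eq: "G ((j + 1) * (pi / 2)) - G (j * (pi / 2)) =
                 ((j + 1) * (pi / 2) - j * (pi / 2)) * (1 / w z)"
      by blast
    have "sin (2 * z) \<noteq> 0"
    proof
      assume "sin (2 * z) = 0"
      then obtain n :: int where n: "2 * z = n * pi"
        by (auto simp: sin_zero_iff_int2)
      have "j * pi < n * pi" "n * pi < (j + 1) * pi"
        using z n by (auto simp: field_simps)
      then have "real_of_int i < real_of_int n" "real_of_int n < real_of_int (i + 1)"
        by (simp_all add: j)
      then have "i < n" "n < i + 1"
        by (simp_all only: of_int_less_iff)
      then show False
        by simp
    qed
    then have "a < w z" "w z < b"
      using ab by auto
    moreover have "G ((j + 1) * (pi / 2)) - G (j * (pi / 2)) = pi / 2 / w z"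
      unfolding eq by (simp add: algebra_simps)
    ultimately show ?thesis
      using a pos[of z] by (simp add: divide_strict_left_mono)
  qed
  have "2 * pi / b < P" "P < 2 * pi / a"
    using quarter[of 0 0] quarter[of 1 1] quarter[of 2 2] quarter[of 3 3]
    by (auto simp: P_def G0)
  ultimately show thesis
    using that by blast
qed

section \<open>The motion of the wire as a rotation\<close>

text \<open>
  The squared angular speed of the rotating point when the displacement is \<open>x\<close>, for amplitude \<open>y0\<close>
  and \<open>k = 2\<sigma>/m\<close>.
\<close>
definition wire_frequency_sq :: "real \<Rightarrow> real \<Rightarrow> real \<Rightarrow> real \<Rightarrow> real \<Rightarrow> real" where
  "wire_frequency_sq k L0 L y0 x = k * (1 - 2 * L0 / (sqrt (L\<^sup>2 + y0\<^sup>2) + sqrt (L\<^sup>2 + x\<^sup>2)))"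

lemma le_wire_length: "0 < L \<Longrightarrow> L \<le> sqrt (L\<^sup>2 + x\<^sup>2)" for L x :: real
  by (rule real_le_rsqrt) simp

lemma wire_length_pos: "0 < L \<Longrightarrow> 0 < sqrt (L\<^sup>2 + x\<^sup>2)" for L x :: real
  using le_wire_length[of L x] by linarith

lemma wire_frequency_sq_strict_mono:
  assumes "0 < k" and "0 < L0" and "0 < L" and "\<bar>x\<bar> < \<bar>x'\<bar>"
  shows "wire_frequency_sq k L0 L y0 x < wire_frequency_sq k L0 L y0 x'"
proof -
  have "x\<^sup>2 < x'\<^sup>2"
    using assms by (metis abs_ge_zero power2_abs power_strict_mono zero_less_numeral)
  then have "sqrt (L\<^sup>2 + x\<^sup>2) < sqrt (L\<^sup>2 + x'\<^sup>2)"
    by simp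
  moreover have "0 < sqrt (L\<^sup>2 + x\<^sup>2)" "0 < sqrt (L\<^sup>2 + y0\<^sup>2)"
    using \<open>0 < L\<close> by (rule wire_length_pos)+
  ultimately show ?thesis
    unfolding wire_frequency_sq_def using assms
    by (intro mult_strict_left_mono diff_strict_left_mono divide_strict_left_mono mult_pos_pos
        add_pos_pos) linarith+
qed

lemma wire_frequency_sq_pos:
  assumes "0 < k" and "0 < L0" and "L0 < L"
  shows "0 < wire_frequency_sq k L0 L y0 x"
proof -
  have "2 * L0 < sqrt (L\<^sup>2 + y0\<^sup>2) + sqrt (L\<^sup>2 + x\<^sup>2)"
    using assms le_wire_length[of L x] le_wire_length[of L y0] by linarith
  then have "2 * L0 / (sqrt (L\<^sup>2 + y0\<^sup>2) + sqrt (L\<^sup>2 + x\<^sup>2)) < 1"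
    using assms by simp
  with assms show ?thesis
    by (simp add: wire_frequency_sq_def)
qed

lemma wire_frequency_sq_has_derivative:
  assumes "0 < L"
  shows "(wire_frequency_sq k L0 L y0 has_real_derivative
    2 * k * L0 * x / (sqrt (L\<^sup>2 + x\<^sup>2) * (sqrt (L\<^sup>2 + y0\<^sup>2) + sqrt (L\<^sup>2 + x\<^sup>2))\<^sup>2)) (at x)"
proof -
  define s where "s = (\<lambda>x. sqrt (L\<^sup>2 + x\<^sup>2))"
  have s_pos: "0 < s x" for x
    unfolding s_def using assms by (rule wire_length_pos)
  have "(s has_real_derivative x / s x) (at x)"
    using s_pos[of x] unfolding s_def by (auto intro!: derivative_eq_intros simp: field_simps)
  moreover have "s y0 + s x \<noteq> 0"
    using s_pos[of y0] s_pos[of x] by linarith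
  ultimately have "((\<lambda>x. k * (1 - 2 * L0 / (s y0 + s x))) has_real_derivative
      2 * k * L0 * x / (s x * (s y0 + s x)\<^sup>2)) (at x)"
    using s_pos[of x] by (auto intro!: derivative_eq_intros simp: power2_eq_square)
  then show ?thesis
    by (simp add: s_def wire_frequency_sq_def[abs_def])
qed

text \<open>Conservation of energy, in factored form.\<close>
lemma wire_energy:
  fixes y v :: "real \<Rightarrow> real"
  assumes "0 < L"
    and y: "\<And>t. (y has_real_derivative v t) (at t)"
    and v: "\<And>t. (v has_real_derivative - (k * (1 - L0 / sqrt (L\<^sup>2 + (y t)\<^sup>2)) * y t)) (at t)"
    and init: "y 0 = y0" "v 0 = 0"
  shows "(v t)\<^sup>2 = (y0\<^sup>2 - (y t)\<^sup>2) * wire_frequency_sq k L0 L y0 (y t)"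
proof -
  define E where "E = (\<lambda>t. (v t)\<^sup>2 + k * ((y t)\<^sup>2 - 2 * L0 * sqrt (L\<^sup>2 + (y t)\<^sup>2)))"
  have S: "0 < L\<^sup>2 + x\<^sup>2" for x
    using \<open>0 < L\<close> by (auto intro: add_pos_nonneg)
  have "(E has_real_derivative 0) (at t)" for t
    unfolding E_def using S[of "y t"]
    by (auto intro!: derivative_eq_intros y v simp: field_simps)
  then have "E t = E 0"
    by (intro DERIV_isconst_all) auto
  then have "(v t)\<^sup>2 = k * (y0\<^sup>2 - (y t)\<^sup>2 - 2 * L0 * (sqrt (L\<^sup>2 + y0\<^sup>2) - sqrt (L\<^sup>2 + (y t)\<^sup>2)))"
    by (simp add: E_def init algebra_simps)
  moreover have "(y0\<^sup>2 - (y t)\<^sup>2) * (2 * L0 / (sqrt (L\<^sup>2 + y0\<^sup>2) + sqrt (L\<^sup>2 + (y t)\<^sup>2)))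
      = 2 * L0 * (sqrt (L\<^sup>2 + y0\<^sup>2) - sqrt (L\<^sup>2 + (y t)\<^sup>2))"
  proof -
    define S0 where "S0 = sqrt (L\<^sup>2 + y0\<^sup>2)"
    define S1 where "S1 = sqrt (L\<^sup>2 + (y t)\<^sup>2)"
    have "S0\<^sup>2 = L\<^sup>2 + y0\<^sup>2" "S1\<^sup>2 = L\<^sup>2 + (y t)\<^sup>2"
      by (simp_all add: S0_def S1_def)
    then have "y0\<^sup>2 - (y t)\<^sup>2 = (S0 - S1) * (S0 + S1)"
      by algebra
    moreover have "0 < S0 + S1"
      unfolding S0_def S1_def using \<open>0 < L\<close> by (intro add_pos_pos wire_length_pos)
    ultimately show ?thesis
      by (simp flip: S0_def S1_def)
  qed
  ultimately show ?thesis
    unfolding wire_frequency_sq_def by algebra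
qed

text \<open>
  The second of the two rotation equations; the first, \<open>y' = sqrt (g(y)) u\<close>, is the definition of
  \<open>u = v / sqrt (g(y))\<close>.
\<close>
lemma wire_rotation:
  fixes y v :: "real \<Rightarrow> real"
  assumes k: "0 < k" and L0: "0 < L0" and L: "L0 < L"
    and y: "\<And>t. (y has_real_derivative v t) (at t)"
    and v: "\<And>t. (v has_real_derivative - (k * (1 - L0 / sqrt (L\<^sup>2 + (y t)\<^sup>2)) * y t)) (at t)"
    and init: "y 0 = y0" "v 0 = 0"
  shows "((\<lambda>t. v t / sqrt (wire_frequency_sq k L0 L y0 (y t))) has_real_derivative
           - (sqrt (wire_frequency_sq k L0 L y0 (y t)) * y t)) (at t)"
proof -
  define g where "g = wire_frequency_sq k L0 L y0 (y t)"
  define S0 where "S0 = sqrt (L\<^sup>2 + y0\<^sup>2)"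
  define S where "S = sqrt (L\<^sup>2 + (y t)\<^sup>2)"
  define D where "D = 2 * k * L0 * y t / (S * (S0 + S)\<^sup>2)"
  have "0 < L"
    using L0 L by simp
  have S: "0 < S" "0 < S0"
    unfolding S_def S0_def using \<open>0 < L\<close> by (rule wire_length_pos)+
  have "0 < g"
    using k L0 L by (simp add: g_def wire_frequency_sq_pos)
  have "(v t)\<^sup>2 = (y0\<^sup>2 - (y t)\<^sup>2) * g"
    using wire_energy[OF \<open>0 < L\<close> y v init] by (simp add: g_def)
  moreover have "S0\<^sup>2 = L\<^sup>2 + y0\<^sup>2" "S\<^sup>2 = L\<^sup>2 + (y t)\<^sup>2"
    by (simp_all add: S0_def S_def)
  then have "y0\<^sup>2 - (y t)\<^sup>2 = (S0 - S) * (S0 + S)"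
    by algebra
  ultimately have energy: "(v t)\<^sup>2 = (S0 - S) * (S0 + S) * g"
    by simp
  have g: "g = k * (1 - 2 * L0 / (S0 + S))"
    by (simp add: g_def S0_def S_def wire_frequency_sq_def)
  \<comment> \<open>\<open>D\<close> is the derivative of \<open>g\<close> with respect to the displacement, and \<open>(S0 - S) (S0 + S)\<close>
    is \<open>v\<^sup>2 / g\<close>: the identity below is what makes the rotation equation exact.\<close>
  have key: "k * (1 - L0 / S) * y t + (S0 - S) * (S0 + S) * D / 2 = g * y t"
    using S add_pos_pos[OF S] unfolding D_def g by (simp add: divide_simps power2_eq_square) algebra
  have "((\<lambda>t. wire_frequency_sq k L0 L y0 (y t)) has_real_derivative D * v t) (at t)"
    using DERIV_chain2[OF wire_frequency_sq_has_derivative[OF \<open>0 < L\<close>] y]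
    by (simp add: D_def S_def S0_def)
  then have "((\<lambda>t. v t / sqrt (wire_frequency_sq k L0 L y0 (y t))) has_real_derivative
     (- (k * (1 - L0 / S) * y t) * sqrt g - v t * (D * v t / (2 * sqrt g))) / g) (at t)"
    using \<open>0 < g\<close> unfolding g_def S_def
    by (auto intro!: derivative_eq_intros v simp: field_simps)
  also have "(- (k * (1 - L0 / S) * y t) * sqrt g - v t * (D * v t / (2 * sqrt g))) / g
      = - (k * (1 - L0 / S) * y t + (v t)\<^sup>2 / g * D / 2) / sqrt g"
  proof -
    define r where "r = sqrt g"
    have "0 < r" "g = r\<^sup>2"
      using \<open>0 < g\<close> by (simp_all add: r_def)
    then show ?thesis
      by (simp flip: r_def add: field_simps power2_eq_square)
  qed
  also have "(v t)\<^sup>2 / g = (S0 - S) * (S0 + S)"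
    using \<open>0 < g\<close> by (simp add: energy)
  also have "- (k * (1 - L0 / S) * y t + (S0 - S) * (S0 + S) * D / 2) / sqrt g = - (sqrt g * y t)"
    unfolding key using \<open>0 < g\<close> by (simp add: field_simps)
  finally show ?thesis
    by (simp add: g_def)
qed

section \<open>The period and its bounds\<close>

theorem theorem1:
  fixes m \<sigma> L0 L y0 :: real and y :: "real \<Rightarrow> real"
  assumes "m > 0" and "\<sigma> > 0" and "0 < L0" and "L0 < L" and "y0 > 0"
    and "wire_motion m \<sigma> L0 L y0 y"
  shows "\<exists>P. least_positive_period y P \<and>
           relative_error P (rayleigh_period m \<sigma> L0 L) < 0 \<and>
           sqrt ((1 / L0 - 2 / (L + sqrt (L\<^sup>2 + y0\<^sup>2))) / (1 / L0 - 1 / L))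
             < rayleigh_period m \<sigma> L0 L / P \<and>
           rayleigh_period m \<sigma> L0 L / P
             < sqrt ((1 / L0 - 1 / sqrt (L\<^sup>2 + y0\<^sup>2)) / (1 / L0 - 1 / L))"
proof -
  define k where "k = 2 * \<sigma> / m"
  define g where "g = wire_frequency_sq k L0 L y0"
  have k: "0 < k" and "0 < L"
    using assms by (auto simp: k_def)
  have gpos: "0 < g x" for x
    using k assms by (simp add: g_def wire_frequency_sq_pos)
  from assms(6) obtain v a where y: "\<And>t. (y has_real_derivative v t) (at t)"
    and va: "\<And>t. (v has_real_derivative a t) (at t)"
    and a: "\<And>t. a t + (2 * \<sigma> / m * ((sqrt (L\<^sup>2 + (y t)\<^sup>2) - L0) / sqrt (L\<^sup>2 + (y t)\<^sup>2))) * y t = 0"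
    and init: "y 0 = y0" "v 0 = 0"
    unfolding wire_motion_def by blast
  have v: "(v has_real_derivative - (k * (1 - L0 / sqrt (L\<^sup>2 + (y t)\<^sup>2)) * y t)) (at t)" for t
  proof -
    have "(sqrt (L\<^sup>2 + (y t)\<^sup>2) - L0) / sqrt (L\<^sup>2 + (y t)\<^sup>2) = 1 - L0 / sqrt (L\<^sup>2 + (y t)\<^sup>2)"
      using wire_length_pos[OF \<open>0 < L\<close>, of "y t"]
      by (metis diff_divide_distrib divide_self less_irrefl)
    then have "a t = - (k * (1 - L0 / sqrt (L\<^sup>2 + (y t)\<^sup>2)) * y t)"
      using a[of t] unfolding k_def by (simp only: eq_neg_iff_add_eq_0)
    with va[of t] show ?thesis
      by simp
  qed
  have g_cont: "isCont g x" for x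
    using DERIV_isCont[OF wire_frequency_sq_has_derivative[OF \<open>0 < L\<close>]] by (simp add: g_def)
  have y_cont: "isCont y t" for t
    using y by (rule DERIV_isCont)
  have "isCont (\<lambda>t. sqrt (g (y t))) t" for t
    by (intro continuous_intros isCont_o2[OF y_cont g_cont])
  then obtain \<theta> where \<theta>0: "\<theta> 0 = 0" and \<theta>: "\<And>t. (\<theta> has_real_derivative sqrt (g (y t))) (at t)"
    using antiderivative_vanishing_at_0 by blast
  have cos: "y t = y0 * cos (\<theta> t)" for t
  proof -
    have "(y has_real_derivative sqrt (g (y t)) * (v t / sqrt (g (y t)))) (at t)" for t
      using y[of t] gpos[of "y t"] by simp
    from rotating_frame_cos[OF this wire_rotation[OF k assms(3,4) y v init, folded g_def] \<theta> _ \<theta>0]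
    show ?thesis
      by (simp add: init)
  qed
  define w where "w = (\<lambda>x. sqrt (g (y0 * cos x)))"
  have w_bounds: "sqrt (g 0) < w x \<and> w x < sqrt (g y0)" if "sin (2 * x) \<noteq> 0" for x
  proof -
    have "cos x \<noteq> 0" "sin x \<noteq> 0"
      using that by (auto simp: sin_double)
    moreover have "\<bar>cos x\<bar> < 1"
    proof -
      have "0 < (sin x)\<^sup>2"
        using \<open>sin x \<noteq> 0\<close> by simp
      then have "(cos x)\<^sup>2 < 1"
        using sin_cos_squared_add[of x] by linarith
      then show ?thesis
        by (simp add: abs_square_less_1)
    qed
    ultimately have "\<bar>0\<bar> < \<bar>y0 * cos x\<bar>" "\<bar>y0 * cos x\<bar> < \<bar>y0\<bar>"
      using \<open>y0 > 0\<close> by (auto simp: abs_mult)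
    then show ?thesis
      using wire_frequency_sq_strict_mono[OF k \<open>0 < L0\<close> \<open>0 < L\<close>] by (simp add: w_def g_def)
  qed
  have "isCont w x" for x
    unfolding w_def by (intro continuous_intros isCont_o2[OF _ g_cont])
  moreover have "(\<theta> has_real_derivative w (\<theta> t)) (at t)" for t
    using \<theta>[of t] by (simp add: w_def cos)
  moreover have "0 < w x" "w (x + 2 * pi) = w x" for x
    using gpos by (auto simp: w_def)
  moreover have "0 < sqrt (g 0)"
    using gpos by simp
  ultimately obtain P where P: "least_positive_period y P"
    and P_gt: "2 * pi / sqrt (g y0) < P" and P_lt: "P < 2 * pi / sqrt (g 0)"
    using phase_flow_period[of y0 y \<theta> w "sqrt (g 0)" "sqrt (g y0)"] \<open>y0 > 0\<close> cos \<theta>0 w_bounds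
    by blast
  have "0 < P"
    using P by (simp add: least_positive_period_def)
  \<comment> \<open>\<open>R\<close> is the square of Rayleigh's angular frequency.\<close>
  define R where "R = k * L0 * (1 / L0 - 1 / L)"
  have "0 < 1 / L0 - 1 / L"
    using assms by (simp add: field_simps)
  then have "0 < R"
    using k assms by (simp add: R_def)
  have "2 * (\<sigma> * (L - L0)) / (m * L) = R"
    using assms \<open>0 < L\<close> by (simp add: R_def k_def field_simps)
  then have rayleigh: "rayleigh_period m \<sigma> L0 L = 2 * pi / sqrt R"
    by (simp add: rayleigh_period_def)
  have g0: "g 0 = k * L0 * (1 / L0 - 2 / (L + sqrt (L\<^sup>2 + y0\<^sup>2)))"
    using assms \<open>0 < L\<close> le_wire_length[of L y0]
    by (simp add: g_def wire_frequency_sq_def field_simps)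
  have gy0: "g y0 = k * L0 * (1 / L0 - 1 / sqrt (L\<^sup>2 + y0\<^sup>2))"
    using assms \<open>0 < L\<close> le_wire_length[of L y0]
    by (simp add: g_def wire_frequency_sq_def field_simps)
  have kL0: "k * L0 \<noteq> 0"
    using k assms by simp
  have lower_eq: "(1 / L0 - 2 / (L + sqrt (L\<^sup>2 + y0\<^sup>2))) / (1 / L0 - 1 / L) = g 0 / R"
    unfolding g0 R_def mult_divide_mult_cancel_left[OF kL0] ..
  have upper_eq: "(1 / L0 - 1 / sqrt (L\<^sup>2 + y0\<^sup>2)) / (1 / L0 - 1 / L) = g y0 / R"
    unfolding gy0 R_def mult_divide_mult_cancel_left[OF kL0] ..
  have lower: "sqrt (g 0 / R) < rayleigh_period m \<sigma> L0 L / P"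
    using P_lt \<open>0 < P\<close> \<open>0 < R\<close> gpos[of 0] unfolding rayleigh
    by (simp add: real_sqrt_divide field_simps)
  have upper: "rayleigh_period m \<sigma> L0 L / P < sqrt (g y0 / R)"
    using P_gt \<open>0 < P\<close> \<open>0 < R\<close> gpos[of y0] unfolding rayleigh
    by (simp add: real_sqrt_divide field_simps)
  have "L < sqrt (L\<^sup>2 + y0\<^sup>2)"
    using \<open>y0 > 0\<close> by (intro real_less_rsqrt) simp
  then have "2 / (L + sqrt (L\<^sup>2 + y0\<^sup>2)) < 1 / L"
    using \<open>0 < L\<close> by (simp add: field_simps)
  then have "R < g 0"
    unfolding R_def g0 using k assms by (intro mult_strict_left_mono) auto
  then have "1 < sqrt (g 0 / R)"
    using \<open>0 < R\<close> by simp
  with lower have "1 < rayleigh_period m \<sigma> L0 L / P"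
    by linarith
  then have "relative_error P (rayleigh_period m \<sigma> L0 L) < 0"
    using \<open>0 < P\<close> by (simp add: relative_error_def field_simps)
  with P lower upper show ?thesis
    unfolding lower_eq upper_eq by blast
qed

end
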